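(* If $Q$ is a basic sequence that is infinite in limit, then the set of real numbers $x$ such that the sequence $(T_{Q,n}(x))_{n=0}^\infty$ has no asymptotic distribution function has Lebesgue measure zero and Hausdorff dimension $1$.
   Context: A basic sequence is $Q=(q_n)_{n\ge1}$ with integers $q_n\ge2$; infinite in limit means $q_n\to\infty$. $T_{Q,n}(x)=q_n\cdots q_1x\bmod1$. An asymptotic distribution function (adf) is a non-decreasing $f:[0,1]\to[0,1]$ with $f(0)=0$, $f(1)=1$; a sequence $(x_i)$ in $[0,1)$ has adf $f$ if $\lim_n\#\{i\le n:x_i\in[0,x)\}/n=f(x)$ for every $x\in[0,1]$. *)

theory Defs
  imports "HOL-Analysis.Analysis"
begin

definition basic_sequence :: "(nat \<Rightarrow> nat) \<Rightarrow> bool" where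
  "basic_sequence q \<longleftrightarrow> (\<forall>n\<ge>1. q n \<ge> 2)"

definition infinite_in_limit :: "(nat \<Rightarrow> nat) \<Rightarrow> bool" where
  "infinite_in_limit q \<longleftrightarrow> filterlim q at_top sequentially"

definition T :: "(nat \<Rightarrow> nat) \<Rightarrow> nat \<Rightarrow> real \<Rightarrow> real" where
  "T q n x = frac (real (\<Prod>i=1..n. q i) * x)"

definition adf :: "(real \<Rightarrow> real) \<Rightarrow> bool" where
  "adf f \<longleftrightarrow> f ` {0..1} \<subseteq> {0..1} \<and> mono_on {0..1} f \<and> f 0 = 0 \<and> f 1 = 1"

text \<open>Sequences are indexed from 0, so the first \<open>n\<close> terms are those with index \<open>i < n\<close>.\<close>

definition has_adf :: "(nat \<Rightarrow> real) \<Rightarrow> (real \<Rightarrow> real) \<Rightarrow> bool" where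
  "has_adf X f \<longleftrightarrow> adf f \<and>
     (\<forall>x\<in>{0..1}. (\<lambda>n. real (card {i. i < n \<and> X i \<in> {0..<x}}) / real n) \<longlonglongrightarrow> f x)"

text \<open>The weight of a covering set is \<open>diam(U)\<^sup>s\<close>, with the usual conventions that the empty
  set has weight 0 and that \<open>0\<^sup>0 = 1\<close> for nonempty \<open>U\<close> (whereas \<open>0 powr 0 = 0\<close>).
  Covering sets are required to be bounded because \<open>diameter\<close> carries no information
  on unbounded sets.\<close>

definition diam_weight :: "real \<Rightarrow> 'a::metric_space set \<Rightarrow> ennreal" where
  "diam_weight s U =
     (if U = {} then 0 else if s = 0 then 1 else ennreal (diameter U powr s))"

definition hausdorff_premeasure :: "real \<Rightarrow> real \<Rightarrow> 'a::metric_space set \<Rightarrow> ennreal" where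
  "hausdorff_premeasure s \<delta> A =
     (INF U \<in> {U :: nat \<Rightarrow> 'a set. A \<subseteq> (\<Union>i. U i) \<and> (\<forall>i. bounded (U i) \<and> diameter (U i) \<le> \<delta>)}.
        \<Sum>i. diam_weight s (U i))"

definition hausdorff_measure :: "real \<Rightarrow> 'a::metric_space set \<Rightarrow> ennreal" where
  "hausdorff_measure s A = (SUP \<delta>\<in>{0<..}. hausdorff_premeasure s \<delta> A)"

definition hausdorff_dim :: "'a::metric_space set \<Rightarrow> ereal" where
  "hausdorff_dim A = Inf {ereal s | s. 0 \<le> s \<and> hausdorff_measure s A = 0}"

end

theory Submission
  imports Defs "HOL-Library.Discrete_Functions"
begin

text \<open>
  Write \<open>N\<^sub>n = q\<^sub>1 \<cdots> q\<^sub>n\<close>.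

  Measure zero: the function \<open>h(u) = [frac u < t] - t\<close> has a bounded 1-periodic antiderivative,
  so \<open>h(N\<^sub>i x)\<close> and \<open>h(N\<^sub>j x)\<close> have correlation at most \<open>N\<^sub>i / N\<^sub>j \<le> 2\<^bsup>i - j\<^esup>\<close> for \<open>i \<le> j\<close> on every interval
  \<open>[a, a + 1]\<close> with \<open>a\<close> an integer. Hence the second moment of \<open>\<Sum>\<^bsub>i<n\<^esub> h(N\<^sub>i x)\<close> is \<open>O(n)\<close>; summing
  over the squares \<open>n = k\<^sup>2\<close> and interpolating shows that almost every orbit is uniformly distributed.

  Dimension one: only allow digits from the bottom quarter of \<open>{0..<q\<^bsub>i+1\<^esub>}\<close> if \<open>i\<close> lies in \<open>[2\<^sup>k, 2\<^bsup>k+1\<^esup>)\<close>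
  with \<open>k\<close> even, and from the quarter above the middle otherwise. Then the frequency of \<open>T\<^sub>i x < 3/10\<close> oscillates,
  so no distribution function exists. Mapping the digits of \<open>y \<in> [0, 1)\<close> in the base of the numbers
  of allowed digits to the allowed digits gives a map \<open>\<phi>\<close> into this set that never contracts cells. A level-\<open>n\<close>
  cell loses a factor of at most \<open>8\<^sup>n\<close> in relative size, which is \<open>O(N\<^sub>n\<^sup>\<epsilon>)\<close> for every \<open>\<epsilon> > 0\<close> because
  \<open>q\<^sub>n \<rightarrow> \<infinity>\<close>; so the inverse of \<open>\<phi>\<close> is \<open>s\<close>-Hoelder for every \<open>s < 1\<close>, and a cover of the set of small
  \<open>s\<close>-weight would pull back to a cover of \<open>[0, 1)\<close> of length less than 1.
\<close>

section \<open>Almost every orbit is uniformly distributed\<close>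

definition centred_ind :: "real \<Rightarrow> real \<Rightarrow> real" where
  "centred_ind t u = (if frac u < t then 1 else 0) - t"

text \<open>An antiderivative of \<open>centred_ind t\<close>.\<close>

definition saw :: "real \<Rightarrow> real \<Rightarrow> real" where
  "saw t y = min (frac y) t - t * frac y"

lemma frac_eq_diff: "of_int k \<le> x \<Longrightarrow> x < of_int k + 1 \<Longrightarrow> frac x = x - of_int k" for x :: real
  by (simp add: frac_unique_iff)

text \<open>The closed right endpoint is included: \<open>frac\<close> drops to 0 there, but the
  formula also gives \<open>min 1 t - t = 0\<close>. This agreement is what makes \<open>saw\<close>
  continuous across integers.\<close>

lemma saw_on_cell:
  assumes "0 \<le> t" "t \<le> 1" "of_int k \<le> y" "y \<le> of_int k + 1"
  shows "saw t y = min (y - of_int k) t - t * (y - of_int k)"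
proof (cases "y = of_int k + 1")
  case True
  then have "frac y = 0" by (metis frac_eq_0_iff Ints_of_int of_int_1 of_int_add)
  with True assms show ?thesis by (simp add: saw_def)
next
  case False
  with assms have "frac y = y - of_int k" by (intro frac_eq_diff) auto
  then show ?thesis by (simp add: saw_def)
qed

lemma saw_bounds:
  assumes "0 \<le> t" "t \<le> 1"
  shows "0 \<le> saw t y" "saw t y \<le> 1"
proof -
  define f where "f = frac y"
  have f: "0 \<le> f" "f \<le> 1" unfolding f_def by (auto simp: frac_ge_0 less_imp_le frac_lt_1)
  have "t * f \<le> f" "t * f \<le> t" "0 \<le> t * f" using f assms
    by (auto simp: mult_left_le_one_le mult_left_le)
  then show "0 \<le> saw t y" "saw t y \<le> 1"
    using f assms unfolding saw_def f_def[symmetric] min_def by (simp_all only: split: if_split) linarith+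
qed

lemma isCont_saw:
  assumes "0 \<le> t" "t \<le> 1"
  shows "isCont (saw t) x"
proof -
  define k where "k = \<lfloor>x\<rfloor>"
  have cell: "continuous_on {of_int j..of_int j + 1} (saw t)" for j
  proof (subst continuous_on_cong[OF refl])
    show "saw t y = min (y - of_int j) t - t * (y - of_int j)" if "y \<in> {of_int j..of_int j + 1}" for y
      using saw_on_cell[OF assms, of j y] that by auto
    show "continuous_on {of_int j..of_int j + 1} (\<lambda>y. min (y - of_int j) t - t * (y - of_int j))"
      by (intro continuous_intros)
  qed
  \<comment> \<open>Gluing two adjacent closed cells puts \<open>x\<close> in the interior of the
    union even when \<open>x\<close> is an integer.\<close>
  have "continuous_on ({of_int (k-1)..of_int (k-1) + 1} \<union> {of_int k..of_int k + 1}) (saw t)"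
    by (intro continuous_on_closed_Un cell) auto
  moreover have "{of_int (k-1)..of_int (k-1) + 1} \<union> {of_int k..of_int k + 1} = {of_int k - 1..of_int k + (1::real)}"
    by auto
  ultimately have "continuous_on {of_int k - 1<..<of_int k + (1::real)} (saw t)"
    by (metis continuous_on_subset greaterThanLessThan_subseteq_atLeastAtMost_iff order_refl)
  moreover have "x \<in> {of_int k - 1<..<of_int k + (1::real)}"
    unfolding k_def by (simp; linarith)
  ultimately show ?thesis
    by (simp add: continuous_on_eq_continuous_at)
qed

lemma saw_has_derivative:
  assumes "0 \<le> t" "t \<le> 1" "y \<notin> \<int>" "y - t \<notin> \<int>"
  shows "(saw t has_real_derivative centred_ind t y) (at y)"
proof -
  define k where "k = \<lfloor>y\<rfloor>"
  have k: "of_int k < y" "y < of_int k + 1"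
    using assms(3) unfolding k_def by (metis Ints_of_int of_int_floor_le order_le_less) linarith
  have fr: "frac y = y - of_int k" using k by (intro frac_eq_diff) auto
  have ne: "y \<noteq> of_int k + t" using assms(4) by auto
  show ?thesis
  proof (cases "y < of_int k + t")
    case True
    have "((\<lambda>z. (z - of_int k) - t * (z - of_int k)) has_real_derivative 1 - t) (at y)"
      by (auto intro!: derivative_eq_intros)
    then have "(saw t has_real_derivative 1 - t) (at y)"
    proof (rule has_field_derivative_transform_within_open)
      show "open {of_int k<..<of_int k + t}" by simp
      show "y \<in> {of_int k<..<of_int k + t}" using True k by simp
      show "z - of_int k - t * (z - of_int k) = saw t z" if "z \<in> {of_int k<..<of_int k + t}" for z
        using that assms(1,2) by (subst saw_on_cell[of t k]) auto
    qed
    with True fr show ?thesis by (simp add: centred_ind_def)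
  next
    case False
    have "((\<lambda>z. t - t * (z - of_int k)) has_real_derivative 0 - t) (at y)"
      by (auto intro!: derivative_eq_intros)
    then have "(saw t has_real_derivative 0 - t) (at y)"
    proof (rule has_field_derivative_transform_within_open)
      show "open {of_int k + t<..<of_int k + 1}" by simp
      show "y \<in> {of_int k + t<..<of_int k + 1}" using False k ne by simp
      show "t - t * (z - of_int k) = saw t z" if "z \<in> {of_int k + t<..<of_int k + 1}" for z
        using that assms(1,2) by (subst saw_on_cell[of t k]) auto
    qed
    with False fr show ?thesis by (simp add: centred_ind_def)
  qed
qed

lemma centred_ind_has_integral:
  assumes t: "0 \<le> t" "t \<le> 1" and R: "R > 0" and ab: "a \<le> b"
  shows "((\<lambda>v. centred_ind t (R * v)) has_integral (saw t (R * b) - saw t (R * a)) / R) {a..b}"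
proof -
  \<comment> \<open>\<open>J\<close> indexes every kink of \<open>saw\<close> that can meet the
    interval; it starts one below the floor because a kink at \<open>of_int k + t\<close> may have
    \<open>k\<close> as small as \<open>R * a - 1\<close>.\<close>
  define J where "J = {\<lfloor>R * a\<rfloor> - 1..\<lceil>R * b\<rceil>}"
  define S where "S = (\<lambda>k. of_int k / R) ` J \<union> (\<lambda>k. (of_int k + t) / R) ` J"
  have "finite S" by (simp add: S_def J_def)
  have bad: "R * v \<notin> \<int> \<and> R * v - t \<notin> \<int>" if v: "v \<in> {a<..<b} - S" for v
  proof (rule ccontr)
    assume "\<not> ?thesis"
    then obtain k where k: "R * v = of_int k \<or> R * v = of_int k + t"
      by (metis Ints_cases diff_add_cancel)
    have "R * a \<le> R * v" "R * v \<le> R * b" using v R by auto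
    then have "k \<in> J" using k t unfolding J_def by (auto; linarith)
    moreover have "v = of_int k / R \<or> v = (of_int k + t) / R"
      using k R by (metis nonzero_mult_div_cancel_left order_less_irrefl)
    ultimately show False using v by (auto simp: S_def)
  qed
  have "((\<lambda>v. centred_ind t (R * v)) has_integral (saw t (R * b) / R - saw t (R * a) / R)) {a..b}"
  proof (rule fundamental_theorem_of_calculus_interior_strong[OF \<open>finite S\<close> ab])
    fix v assume v: "v \<in> {a<..<b} - S"
    have "((\<lambda>v. saw t (R * v) / R) has_real_derivative (centred_ind t (R * v) * R) / R) (at v)"
      by (intro DERIV_cdivide DERIV_chain2[of "saw t"] saw_has_derivative t)
         (use bad[OF v] in \<open>auto intro!: derivative_eq_intros\<close>)
    then show "((\<lambda>v. saw t (R * v) / R) has_vector_derivative centred_ind t (R * v)) (at v)"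
      using R by (simp add: has_real_derivative_iff_has_vector_derivative)
  next
    have "isCont (\<lambda>v. saw t (R * v) / R) v" for v
      using R isCont_o2[of v "(*) R" "saw t"] isCont_saw[OF t, of "R * v"]
      by (simp add: continuous_divide)
    then show "continuous_on {a..b} (\<lambda>v. saw t (R * v) / R)"
      by (simp add: continuous_at_imp_continuous_on)
  qed
  then show ?thesis by (simp add: diff_divide_distrib)
qed

text \<open>The antiderivative takes values in [0, 1], so the bound does not grow with the length of
  the interval.\<close>

lemma centred_ind_integral_small:
  assumes "0 \<le> t" "t \<le> 1" "R > 0" "a \<le> b"
  obtains I where "((\<lambda>v. centred_ind t (R * v)) has_integral I) {a..b}" "\<bar>I\<bar> \<le> 1 / R"
proof
  show "((\<lambda>v. centred_ind t (R * v)) has_integral (saw t (R * b) - saw t (R * a)) / R) {a..b}"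
    by (rule centred_ind_has_integral[OF assms])
  have "\<bar>saw t (R * b) - saw t (R * a)\<bar> \<le> 1"
    using saw_bounds[OF assms(1,2)] by (smt (verit))
  then show "\<bar>(saw t (R * b) - saw t (R * a)) / R\<bar> \<le> 1 / R"
    using assms(3) by (simp add: divide_right_mono)
qed

text \<open>On each cell of length \<open>1 / N\<close> the slow factor is \<open>1 - t\<close> and
  then \<open>- t\<close>, while the fast factor integrates to at most \<open>1 / (N * R)\<close> on
  either piece. The weights \<open>1 - t\<close> and \<open>t\<close> add up to 1, so a cell
  contributes at most \<open>1 / (N * R)\<close>.\<close>

lemma centred_ind_correlation_cells:
  fixes N R :: real and c :: int and k :: nat
  assumes t: "0 \<le> t" "t \<le> 1" and N: "N > 0" and R: "R > 0"
  shows "\<exists>I. ((\<lambda>x. centred_ind t (N * x) * centred_ind t (N * R * x)) has_integral I)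
            {of_int c / N..(of_int c + real k) / N} \<and> \<bar>I\<bar> \<le> real k / (N * R)"
proof (induction k)
  case 0
  show ?case by (intro exI[of _ 0]) (simp add: has_integral_refl)
next
  case (Suc k)
  let ?g = "\<lambda>x. centred_ind t (N * x) * centred_ind t (N * R * x)"
  let ?a = "of_int c / N" and ?u = "(of_int c + real k) / N"
  let ?v = "(of_int c + real k + t) / N" and ?w = "(of_int c + real (Suc k)) / N"
  have uv: "?a \<le> ?u" "?u \<le> ?v" "?v \<le> ?w"
    using N t by (auto intro!: divide_right_mono)
  obtain I where I: "(?g has_integral I) {?a..?u}" "\<bar>I\<bar> \<le> real k / (N * R)" using Suc by blast
  obtain I1 where I1: "((\<lambda>x. centred_ind t (N * R * x)) has_integral I1) {?u..?v}" "\<bar>I1\<bar> \<le> 1 / (N * R)"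
    using centred_ind_integral_small[OF t _ uv(2), of "N*R"] N R by auto
  obtain I2 where I2: "((\<lambda>x. centred_ind t (N * R * x)) has_integral I2) {?v..?w}" "\<bar>I2\<bar> \<le> 1 / (N * R)"
    using centred_ind_integral_small[OF t _ uv(3), of "N*R"] N R by auto
  have fr: "frac (N * x) = N * x - of_int (c + int k)" if "x \<in> {?u..<?w}" for x
    using that N by (intro frac_eq_diff) (auto simp: field_simps)
  have g1: "?g x = (1 - t) * centred_ind t (N * R * x)" if "x \<in> {?u..?v} - {?v}" for x
  proof -
    have "x \<in> {?u..<?w}" "N * x < of_int c + real k + t" using that uv(3) N by (auto simp: field_simps)
    then show ?thesis using fr[of x] by (simp add: centred_ind_def)
  qed
  have g2: "?g x = - t * centred_ind t (N * R * x)" if "x \<in> {?v..?w} - {?w}" for x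
  proof -
    have "x \<in> {?u..<?w}" "N * x \<ge> of_int c + real k + t" using that uv(2) N t by (auto simp: field_simps)
    then show ?thesis using fr[of x] by (simp add: centred_ind_def)
  qed
  have "(?g has_integral (1 - t) * I1) {?u..?v}"
    \<comment> \<open>The slow factor changes value at the right end of each piece, so that single
      point is discarded.\<close>
    by (rule has_integral_spike_finite[of "{?v}", OF _ _ has_integral_mult_right[OF I1(1)]]) (use g1 in auto)
  moreover have "(?g has_integral - t * I2) {?v..?w}"
    by (rule has_integral_spike_finite[of "{?w}", OF _ _ has_integral_mult_right[OF I2(1)]]) (use g2 in auto)
  ultimately have "(?g has_integral (1 - t) * I1 + - t * I2) {?u..?w}"
    by (rule has_integral_combine[OF uv(2,3)])
  with I(1) have *: "(?g has_integral I + ((1 - t) * I1 + - t * I2)) {?a..?w}"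
    by (rule has_integral_combine[OF uv(1) order_trans[OF uv(2,3)]])
  have "\<bar>(1 - t) * I1\<bar> \<le> (1 - t) * (1 / (N * R))" "\<bar>t * I2\<bar> \<le> t * (1 / (N * R))"
    unfolding abs_mult using t I1(2) I2(2) by (auto intro!: mult_mono simp del: times_divide_eq_right)
  then have "\<bar>(1 - t) * I1 + - t * I2\<bar> \<le> (1 - t) * (1 / (N * R)) + t * (1 / (N * R))" by linarith
  also have "\<dots> = 1 / (N * R)" by (simp add: add_divide_distrib[symmetric])
  finally have "\<bar>I + ((1 - t) * I1 + - t * I2)\<bar> \<le> real k / (N * R) + 1 / (N * R)" using I(2) by linarith
  also have "\<dots> = real (Suc k) / (N * R)" by (simp add: add_divide_distrib)
  finally show ?case using * by blast
qed

text \<open>The unit interval consists of \<open>N\<close> cells starting at index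
  \<open>a * N\<close>, which gives \<open>N / (N * R)\<close>.\<close>

lemma centred_ind_correlation:
  fixes N R :: nat and a :: int
  assumes "0 \<le> t" "t \<le> 1" "N > 0" "R > 0"
  shows "\<exists>I. ((\<lambda>x. centred_ind t (real N * x) * centred_ind t (real (N * R) * x)) has_integral I)
            {of_int a..of_int a + 1} \<and> \<bar>I\<bar> \<le> 1 / real R"
  using centred_ind_correlation_cells[OF assms(1,2), of N R "a * int N" N] assms(3,4)
  by (simp add: add_divide_distrib)


section \<open>Second moments of the discrepancy and almost everywhere convergence\<close>

definition base_prod :: "(nat \<Rightarrow> nat) \<Rightarrow> nat \<Rightarrow> nat" where
  "base_prod q n = (\<Prod>i=1..n. q i)"

lemma base_prod_0 [simp]: "base_prod q 0 = 1"
  by (simp add: base_prod_def)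

lemma base_prod_Suc: "base_prod q (Suc n) = q (Suc n) * base_prod q n"
  by (simp add: base_prod_def mult.commute)

lemma base_prod_pos:
  assumes "\<And>n. q (Suc n) > 0"
  shows "base_prod q n > 0"
  by (induction n) (auto simp: base_prod_Suc assms)

lemma basic_sequence_Suc: "basic_sequence q \<Longrightarrow> q (Suc n) \<ge> 2"
  by (simp add: basic_sequence_def)

lemma basic_sequence_Suc_pos: "basic_sequence q \<Longrightarrow> q (Suc n) > 0"
  by (metis basic_sequence_Suc not_numeral_le_zero gr0I)

lemma base_prod_add:
  assumes "basic_sequence q"
  shows "\<exists>R. base_prod q (i + d) = base_prod q i * R \<and> R \<ge> 2 ^ d"
proof (induction d)
  case (Suc d)
  then obtain R where R: "base_prod q (i + d) = base_prod q i * R" "R \<ge> 2 ^ d" by blast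
  show ?case
    using R basic_sequence_Suc[OF assms, of "i + d"]
    by (intro exI[of _ "q (Suc (i + d)) * R"]) (auto simp: base_prod_Suc intro!: mult_mono)
qed auto

definition discrepancy :: "(nat \<Rightarrow> nat) \<Rightarrow> real \<Rightarrow> nat \<Rightarrow> real \<Rightarrow> real" where
  "discrepancy q t n x = (\<Sum>i<n. centred_ind t (real (base_prod q i) * x))"

text \<open>Passing from \<open>n\<close> to \<open>n + 1\<close> adds twice the cross terms with
  the new summand and one diagonal term. The cross terms are dominated by a geometric series of sum
  at most 1 and the diagonal term is at most 1, hence 3 per step.\<close>

lemma discrepancy_second_moment:
  assumes q: "basic_sequence q" and t: "0 \<le> t" "t \<le> 1"
  shows "\<exists>I. ((\<lambda>x. (discrepancy q t n x)\<^sup>2) has_integral I) {of_int a..of_int a + 1} \<and> I \<le> 3 * real n"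
proof (induction n)
  case 0
  show ?case by (intro exI[of _ 0]) (simp add: discrepancy_def)
next
  case (Suc n)
  let ?h = "\<lambda>i x. centred_ind t (real (base_prod q i) * x)"
  let ?S = "{of_int a..of_int a + 1} :: real set"
  obtain I where I: "((\<lambda>x. (discrepancy q t n x)\<^sup>2) has_integral I) ?S" "I \<le> 3 * real n"
    using Suc by blast
  have "\<exists>J. ((\<lambda>x. ?h i x * ?h n x) has_integral J) ?S \<and> \<bar>J\<bar> \<le> (1/2) ^ (n - i)" if i: "i \<le> n" for i
  proof -
    obtain R where R: "base_prod q n = base_prod q i * R" "R \<ge> 2 ^ (n - i)"
      using base_prod_add[OF q, of i "n - i"] unfolding le_add_diff_inverse[OF i] by blast
    have "R > 0" using R(2) by (rule less_le_trans[rotated]) simp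
    moreover have "base_prod q i > 0" by (intro base_prod_pos basic_sequence_Suc_pos q)
    ultimately obtain J where J: "((\<lambda>x. ?h i x * ?h n x) has_integral J) ?S" "\<bar>J\<bar> \<le> 1 / real R"
      using centred_ind_correlation[OF t, of "base_prod q i" R a] R(1) by auto
    have "real (2 ^ (n - i)) \<le> real R" using R(2) by (simp only: of_nat_le_iff)
    then have "1 / real R \<le> (1/2) ^ (n - i)"
      by (simp add: power_one_over frac_le)
    with J show ?thesis by (intro exI[of _ J]) auto
  qed
  then obtain J where J: "\<And>i. i \<le> n \<Longrightarrow> ((\<lambda>x. ?h i x * ?h n x) has_integral J i) ?S"
      "\<And>i. i \<le> n \<Longrightarrow> \<bar>J i\<bar> \<le> (1/2) ^ (n - i)"
    by metis
  have sq: "(discrepancy q t (Suc n) x)\<^sup>2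
      = (discrepancy q t n x)\<^sup>2 + (2 * (\<Sum>i<n. ?h i x * ?h n x) + ?h n x * ?h n x)" for x
    by (simp add: discrepancy_def power2_eq_square algebra_simps sum_distrib_left sum_distrib_right)
  have "((\<lambda>x. (discrepancy q t (Suc n) x)\<^sup>2) has_integral I + (2 * (\<Sum>i<n. J i) + J n)) ?S"
    unfolding sq by (intro has_integral_add I(1) has_integral_mult_right has_integral_sum J(1)) auto
  moreover have "(\<Sum>i<n. J i) \<le> 1"
  proof -
    have "(\<Sum>i<n. J i) \<le> (\<Sum>i<n. (1/2) ^ (n - i))"
      using J(2) by (intro sum_mono) (metis abs_le_D1 lessThan_iff less_imp_le)
    also have "\<dots> = 1 - (1/2) ^ n"
    proof (induction n)
      case (Suc n)
      have "(\<Sum>i<Suc n. (1/2::real) ^ (Suc n - i)) = (\<Sum>i<n. (1/2) * (1/2) ^ (n - i)) + 1/2"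
        by (simp add: Suc_diff_le)
      also have "\<dots> = 1 - (1/2) ^ Suc n" by (simp add: sum_distrib_left[symmetric] Suc sum_divide_distrib[symmetric] diff_divide_distrib)
      finally show ?case .
    qed simp
    also have "\<dots> \<le> 1" by simp
    finally show ?thesis .
  qed
  moreover have "J n \<le> 1" using J(2)[of n] by simp
  ultimately show ?case using I(2) by (intro exI conjI) auto
qed

lemma centred_ind_measurable [measurable]: "centred_ind t \<in> borel_measurable borel"
  unfolding centred_ind_def frac_def by measurable

lemma discrepancy_measurable [measurable]: "discrepancy q t n \<in> borel_measurable borel"
  unfolding discrepancy_def by measurable

lemma centred_ind_abs_le: "0 \<le> t \<Longrightarrow> t \<le> 1 \<Longrightarrow> \<bar>centred_ind t u\<bar> \<le> 1"
  by (simp add: centred_ind_def)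

text \<open>At \<open>n = (k + 1)^2\<close> the normalised second moment is at most
  \<open>3 / (k + 1)^2\<close>, which is summable. So the series of squares has finite integral, is
  finite almost everywhere, and its terms tend to 0.\<close>

lemma discrepancy_squares_tendsto_AE:
  assumes q: "basic_sequence q" and t: "0 \<le> t" "t \<le> 1"
  shows "AE x in lborel. x \<in> {of_int a..of_int a + 1} \<longrightarrow>
           (\<lambda>k. discrepancy q t ((Suc k)\<^sup>2) x / real ((Suc k)\<^sup>2)) \<longlonglongrightarrow> 0"
proof -
  let ?S = "{of_int a..of_int a + 1} :: real set"
  let ?Z = "\<lambda>k x. discrepancy q t ((Suc k)\<^sup>2) x / real ((Suc k)\<^sup>2)"
  have bound: "(\<integral>\<^sup>+x. ennreal ((?Z k x)\<^sup>2) * indicator ?S x \<partial>lborel) \<le> ennreal (3 * inverse (real (Suc k) ^ 2))" for k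
  proof -
    obtain I where I: "((\<lambda>x. (discrepancy q t ((Suc k)\<^sup>2) x)\<^sup>2) has_integral I) ?S" "I \<le> 3 * real ((Suc k)\<^sup>2)"
      using discrepancy_second_moment[OF q t] by blast
    define c where "c = inverse ((real ((Suc k)\<^sup>2))\<^sup>2)"
    have "((\<lambda>x. c * (discrepancy q t ((Suc k)\<^sup>2) x)\<^sup>2) has_integral c * I) ?S"
      by (rule has_integral_mult_right[OF I(1)])
    moreover have "(\<lambda>x. c * (discrepancy q t ((Suc k)\<^sup>2) x)\<^sup>2) = (\<lambda>x. (?Z k x)\<^sup>2)"
      by (simp add: c_def power_divide field_simps)
    ultimately have "((\<lambda>x. (?Z k x)\<^sup>2) has_integral c * I) ?S" by simp
    then have "(\<integral>\<^sup>+x. ennreal ((?Z k x)\<^sup>2) * indicator ?S x \<partial>lborel) = ennreal (c * I)"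
      by (intro nn_integral_has_integral_lebesgue') auto
    also have "c * I \<le> c * (3 * real ((Suc k)\<^sup>2))" using I(2) by (intro mult_left_mono) (auto simp: c_def)
    also have "c * (3 * real ((Suc k)\<^sup>2)) = 3 * inverse (real (Suc k) ^ 2)"
      unfolding c_def power2_eq_square[of "real ((Suc k)\<^sup>2)"] inverse_mult_distrib
      by (simp del: of_nat_Suc power_Suc)
    finally show ?thesis by (simp add: ennreal_leI)
  qed
  have "(\<integral>\<^sup>+x. (\<Sum>k. ennreal ((?Z k x)\<^sup>2) * indicator ?S x) \<partial>lborel)
      = (\<Sum>k. \<integral>\<^sup>+x. ennreal ((?Z k x)\<^sup>2) * indicator ?S x \<partial>lborel)"
    by (intro nn_integral_suminf) measurable
  also have "\<dots> \<le> (\<Sum>k. ennreal (3 * inverse (real (Suc k) ^ 2)))"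
    by (intro suminf_le bound) auto
  also have "\<dots> < \<infinity>"
  proof -
    have "summable (\<lambda>k. 3 * inverse (real (Suc k) ^ 2))"
      by (intro summable_mult) (subst summable_Suc_iff[where f="\<lambda>k. inverse (real k ^ 2)"], simp add: inverse_power_summable)
    then show ?thesis by (subst suminf_ennreal2) auto
  qed
  finally have "AE x in lborel. (\<Sum>k. ennreal ((?Z k x)\<^sup>2) * indicator ?S x) \<noteq> \<infinity>"
    by (intro nn_integral_PInf_AE) (auto simp: less_top)
  then show ?thesis
  proof eventually_elim
    case (elim x)
    show ?case
    proof
      assume "x \<in> ?S"
      then have "(\<Sum>k. ennreal ((?Z k x)\<^sup>2)) \<noteq> top" using elim by simp
      then have "summable (\<lambda>k. (?Z k x)\<^sup>2)" by (intro summable_suminf_not_top) auto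
      then have "(\<lambda>k. (?Z k x)\<^sup>2) \<longlonglongrightarrow> 0" by (rule summable_LIMSEQ_zero)
      then have "(\<lambda>k. sqrt ((?Z k x)\<^sup>2)) \<longlonglongrightarrow> sqrt 0" by (rule tendsto_real_sqrt)
      then show "(\<lambda>k. ?Z k x) \<longlonglongrightarrow> 0" by (simp only: real_sqrt_abs real_sqrt_zero tendsto_rabs_zero_iff)
    qed
  qed
qed

lemma tendsto_ratio_from_squares:
  fixes D :: "nat \<Rightarrow> real"
  assumes step: "\<And>n. \<bar>D (Suc n) - D n\<bar> \<le> 1"
    and sq: "(\<lambda>k. D ((Suc k)\<^sup>2) / real ((Suc k)\<^sup>2)) \<longlonglongrightarrow> 0"
  shows "(\<lambda>n. D n / real n) \<longlonglongrightarrow> 0"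
proof -
  \<comment> \<open>Between consecutive squares \<open>D\<close> moves by at most
    \<open>2 * k\<close>; relative to \<open>k^2\<close> this is the term
    \<open>2 / k\<close>.\<close>
  define E where "E k = \<bar>D (k\<^sup>2) / real (k\<^sup>2)\<bar> + 2 / real k" for k
  have "(\<lambda>k. D (k\<^sup>2) / real (k\<^sup>2)) \<longlonglongrightarrow> 0"
    using sq by (simp only: filterlim_sequentially_Suc[where f="\<lambda>k. D (k\<^sup>2) / real (k\<^sup>2)"])
  then have "E \<longlonglongrightarrow> 0 + 0"
    unfolding E_def by (intro tendsto_add tendsto_rabs_zero lim_const_over_n)
  moreover have "filterlim floor_sqrt at_top sequentially"
    unfolding filterlim_at_top eventually_sequentially
    by (metis floor_sqrt_inverse_power2 mono_floor_sqrt')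
  ultimately have lim: "(\<lambda>n. E (floor_sqrt n)) \<longlonglongrightarrow> 0"
    using filterlim_compose[of E] by simp
  have diff: "\<bar>D (m + d) - D m\<bar> \<le> real d" for m d
  proof (induction d)
    case (Suc d)
    then show ?case using step[of "m + d"] by simp
  qed simp
  have "\<bar>D n / real n\<bar> \<le> E (floor_sqrt n)" if "n > 0" for n
  proof -
    define k where "k = floor_sqrt n"
    have k: "k\<^sup>2 \<le> n" "n < (Suc k)\<^sup>2" "k > 0"
      using that by (auto simp: k_def Suc_floor_sqrt_power2_gt)
    have "n - k\<^sup>2 \<le> 2 * k" using k(2) by (simp add: power2_eq_square)
    then have "\<bar>D n\<bar> \<le> \<bar>D (k\<^sup>2)\<bar> + 2 * real k"
      using diff[of "k\<^sup>2" "n - k\<^sup>2"] k(1) by (simp add: of_nat_diff[symmetric] del: of_nat_diff)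
    then have "\<bar>D n\<bar> / real n \<le> (\<bar>D (k\<^sup>2)\<bar> + 2 * real k) / real (k\<^sup>2)"
      using k that by (intro frac_le) auto
    also have "\<dots> = E k" using k(3) by (simp add: E_def field_simps power2_eq_square)
    finally show ?thesis by (simp add: k_def)
  qed
  then show ?thesis
    by (intro Lim_null_comparison[OF _ lim]) (auto simp: eventually_sequentially intro!: exI[of _ 1])
qed

lemma discrepancy_tendsto_AE:
  assumes q: "basic_sequence q" and t: "0 \<le> t" "t \<le> 1"
  shows "AE x in lborel. (\<lambda>n. discrepancy q t n x / real n) \<longlonglongrightarrow> 0"
proof -
  have "AE x in lborel. \<forall>a. x \<in> {of_int a..of_int a + 1} \<longrightarrow>
           (\<lambda>k. discrepancy q t ((Suc k)\<^sup>2) x / real ((Suc k)\<^sup>2)) \<longlonglongrightarrow> 0"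
    unfolding AE_all_countable using discrepancy_squares_tendsto_AE[OF assms] by blast
  then show ?thesis
  proof eventually_elim
    case (elim x)
    have "x \<in> {of_int \<lfloor>x\<rfloor>..of_int \<lfloor>x\<rfloor> + 1}" by (simp add: less_imp_le)
    with elim have "(\<lambda>k. discrepancy q t ((Suc k)\<^sup>2) x / real ((Suc k)\<^sup>2)) \<longlonglongrightarrow> 0" by blast
    then show ?case
      by (intro tendsto_ratio_from_squares) (use centred_ind_abs_le[OF t] in \<open>auto simp: discrepancy_def\<close>)
  qed
qed

section \<open>From discrepancies to distribution functions\<close>

lemma T_eq: "T q n x = frac (real (base_prod q n) * x)"
  by (simp add: T_def base_prod_def)

lemma discrepancy_eq_count:
  "discrepancy q t n x = real (card {i. i < n \<and> T q i x \<in> {0..<t}}) - real n * t"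
proof -
  have "(\<Sum>i<n. if T q i x < t then 1 else 0) = real (card {i. i < n \<and> T q i x \<in> {0..<t}})"
    by (subst sum.inter_filter[symmetric]) (auto simp: T_eq frac_ge_0 intro!: arg_cong[where f=card])
  then show ?thesis
    by (simp add: discrepancy_def centred_ind_def sum_subtractf T_eq)
qed

lemma frequency_mono:
  "s \<le> t \<Longrightarrow> real (card {i. i < n \<and> X i \<in> {0..<s}}) / real n
     \<le> real (card {i. i < n \<and> X i \<in> {0..<t}}) / real n" for s t :: real
  by (intro divide_right_mono of_nat_mono card_mono) auto

text \<open>A countable union of null sets is null, so almost everywhere statements combine over
  rational thresholds. An irrational threshold is squeezed between nearby rational ones, using that
  frequencies are monotone and the limit is continuous.\<close>

lemma has_adf_id_if_rational_frequencies:
  fixes X :: "nat \<Rightarrow> real"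
  assumes rng: "\<And>i. X i \<in> {0..<1}"
    and rat: "\<And>r. r \<in> \<rat> \<Longrightarrow> 0 \<le> r \<Longrightarrow> r \<le> 1 \<Longrightarrow>
      (\<lambda>n. real (card {i. i < n \<and> X i \<in> {0..<r}}) / real n) \<longlonglongrightarrow> r"
  shows "has_adf X (\<lambda>x. x)"
proof -
  let ?F = "\<lambda>t n. real (card {i. i < n \<and> X i \<in> {0..<t}}) / real n"
  have "?F t \<longlonglongrightarrow> t" if "t \<in> {0..1}" for t
  proof (cases "t \<in> \<rat>")
    case True
    with rat that show ?thesis by simp
  next
    case False
    have t: "0 < t" "t < 1" using that False Rats_0 Rats_1 by (metis atLeastAtMost_iff order_le_less)+
    show ?thesis
    proof (rule tendstoI)
      fix e :: real assume "e > 0"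
      obtain r where r: "r \<in> \<rat>" "max 0 (t - e/2) < r" "r < t"
        using Rats_dense_in_real[of "max 0 (t - e/2)" t] t \<open>e > 0\<close> by auto
      obtain r' where r': "r' \<in> \<rat>" "t < r'" "r' < min 1 (t + e/2)"
        using Rats_dense_in_real[of t "min 1 (t + e/2)"] t \<open>e > 0\<close> by auto
      have "eventually (\<lambda>n. dist (?F r n) r < e/2) sequentially" "eventually (\<lambda>n. dist (?F r' n) r' < e/2) sequentially"
        using tendstoD[OF rat[of r], of "e/2"] tendstoD[OF rat[of r'], of "e/2"] r r' t \<open>e > 0\<close> by auto
      then show "eventually (\<lambda>n. dist (?F t n) t < e) sequentially"
      proof eventually_elim
        case (elim n)
        then show ?case
          using frequency_mono[of r t n X] frequency_mono[of t r' n X] r r'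
          unfolding dist_real_def min_less_iff_conj max_less_iff_conj by linarith
      qed
    qed
  qed
  then show ?thesis
    by (simp add: has_adf_def adf_def mono_on_def)
qed

lemma has_adf_AE:
  assumes "basic_sequence q"
  shows "AE x in lborel. has_adf (\<lambda>n. T q n x) (\<lambda>x. x)"
proof -
  have "AE x in lborel. \<forall>r\<in>\<rat> \<inter> {0..1}. (\<lambda>n. discrepancy q r n x / real n) \<longlonglongrightarrow> 0"
    using discrepancy_tendsto_AE[OF assms] countable_rat
    by (subst AE_ball_countable) (auto intro: countable_Int1)
  then show ?thesis
  proof eventually_elim
    case (elim x)
    show ?case
    proof (rule has_adf_id_if_rational_frequencies)
      show "T q i x \<in> {0..<1}" for i by (simp add: T_eq frac_ge_0 frac_lt_1)
    next
      fix r :: real assume "r \<in> \<rat>" "0 \<le> r" "r \<le> 1"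
      with elim have "(\<lambda>n. discrepancy q r n x / real n + r) \<longlonglongrightarrow> 0 + r"
        by (intro tendsto_add) auto
      \<comment> \<open>At \<open>n = 0\<close> division by zero makes the left side
        \<open>r\<close> and the right side 0, so the identity is only claimed eventually.\<close>
      moreover have "eventually (\<lambda>n. discrepancy q r n x / real n + r
          = real (card {i. i < n \<and> T q i x \<in> {0..<r}}) / real n) sequentially"
        using eventually_gt_at_top[of 0] by eventually_elim (simp add: discrepancy_eq_count field_simps)
      ultimately show "(\<lambda>n. real (card {i. i < n \<and> T q i x \<in> {0..<r}}) / real n) \<longlonglongrightarrow> r"
        using tendsto_cong by fastforce
    qed
  qed
qed

lemma no_adf_null:
  assumes "basic_sequence q"
  shows "{x. \<not> (\<exists>f. has_adf (\<lambda>n. T q n x) f)} \<in> null_sets lebesgue"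
proof -
  have "AE x in lebesgue. \<exists>f. has_adf (\<lambda>n. T q n x) f"
    using AE_completion[OF has_adf_AE[OF assms]] by eventually_elim blast
  then show ?thesis
    by (simp add: completion.AE_iff_null_sets)
qed

section \<open>Hausdorff measures on the real line\<close>

lemma hausdorff_premeasure_real_le:
  fixes A :: "real set"
  assumes s: "s > 1" and \<eta>: "0 < \<eta>" "\<eta> \<le> \<delta>"
  shows "hausdorff_premeasure s \<delta> A \<le> ennreal ((2 * \<eta>) powr s * (\<Sum>j. real (Suc j) powr - s))"
proof -
  \<comment> \<open>The harmonic series diverges while its \<open>s\<close>-th powers converge, so intervals of length
    \<open>\<eta> / i\<close> laid end to end in both directions cover the line with finite weight.\<close>
  define U where "U j = (if even j then {\<eta> * harm (j div 2)..\<eta> * harm (Suc (j div 2))}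
      else {- (\<eta> * harm (Suc (j div 2)))..- (\<eta> * harm (j div 2))} :: real set)" for j :: nat
  have step: "\<eta> * harm (Suc i) = \<eta> * harm i + \<eta> / real (Suc i)" for i
    by (simp add: harm_Suc algebra_simps inverse_eq_divide)
  have diam: "diameter (U j) = \<eta> / real (Suc (j div 2))" for j
  proof -
    have "\<eta> / real (Suc (j div 2)) \<ge> 0" using \<eta> by simp
    then show ?thesis unfolding U_def step by (simp add: not_less del: of_nat_Suc)
  qed
  have ne: "U j \<noteq> {}" for j
    using \<eta> by (auto simp: U_def step)
  have cover: "A \<subseteq> (\<Union>j. U j)"
  proof
    fix x
    have "\<exists>n. \<bar>x\<bar> / \<eta> < harm n"
      using filterlim_at_top_dense[THEN iffD1, OF harm_at_top] eventually_happens'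
      by (metis sequentially_bot)
    then have "\<exists>n. \<bar>x\<bar> < \<eta> * harm n" using \<eta> by (simp add: field_simps)
    \<comment> \<open>The least such \<open>n\<close> identifies the interval that contains
      \<open>x\<close>; it is positive because \<open>harm 0 = 0\<close>.\<close>
    define n where "n = (LEAST n. \<bar>x\<bar> < \<eta> * harm n)"
    have n: "\<bar>x\<bar> < \<eta> * harm n" unfolding n_def by (rule LeastI_ex) fact
    then have "n \<noteq> 0" by (intro notI) (simp add: harm_def)
    then obtain i where i: "n = Suc i" using not0_implies_Suc by blast
    have "\<eta> * harm i \<le> \<bar>x\<bar>"
      using not_less_Least[of i "\<lambda>n. \<bar>x\<bar> < \<eta> * harm n"] i unfolding n_def by simp
    with n i have "x \<in> U (if x \<ge> 0 then 2 * i else 2 * i + 1)"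
      by (auto simp: U_def)
    then show "x \<in> (\<Union>j. U j)" by blast
  qed
  have weight: "diam_weight s (U j) \<le> ennreal ((2 * \<eta>) powr s * real (Suc j) powr - s)" for j
  proof -
    \<comment> \<open>Each length occurs twice, once on either side of 0; this is the origin of the
      factor 2 in the bound.\<close>
    have "Suc j \<le> 2 * Suc (j div 2)" by presburger
    then have "real (Suc j) \<le> 2 * real (Suc (j div 2))" by linarith
    then have "2 * \<eta> / (2 * real (Suc (j div 2))) \<le> 2 * \<eta> / real (Suc j)"
      using \<eta> by (intro divide_left_mono) auto
    then have "\<eta> / real (Suc (j div 2)) \<le> 2 * \<eta> / real (Suc j)" by (simp del: of_nat_Suc)
    then have "(\<eta> / real (Suc (j div 2))) powr s \<le> (2 * \<eta> / real (Suc j)) powr s"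
      using \<eta> s by (intro powr_mono2) auto
    also have "\<dots> = (2 * \<eta>) powr s * real (Suc j) powr - s"
      using \<eta> by (simp add: powr_divide powr_minus_divide)
    finally show ?thesis using s ne[of j] by (simp add: diam_weight_def diam ennreal_leI)
  qed
  have summ: "summable (\<lambda>j. real (Suc j) powr - s)"
    by (subst summable_Suc_iff[where f="\<lambda>j. real j powr - s"]) (use s in \<open>simp add: summable_real_powr_iff\<close>)
  have "bounded (U j) \<and> diameter (U j) \<le> \<delta>" for j
  proof -
    have "\<eta> / real (Suc (j div 2)) \<le> \<eta> / 1" using \<eta> by (intro frac_le) auto
    then show ?thesis using \<eta> diam[of j] by (auto simp: U_def)
  qed
  then have "hausdorff_premeasure s \<delta> A \<le> (\<Sum>j. diam_weight s (U j))"
    unfolding hausdorff_premeasure_def using cover by (intro INF_lower) auto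
  also have "\<dots> \<le> (\<Sum>j. ennreal ((2 * \<eta>) powr s * real (Suc j) powr - s))"
    by (intro suminf_le weight) auto
  also have "\<dots> = ennreal (\<Sum>j. (2 * \<eta>) powr s * real (Suc j) powr - s)"
    by (intro suminf_ennreal2 summable_mult summ) auto
  also have "(\<Sum>j. (2 * \<eta>) powr s * real (Suc j) powr - s) = (2 * \<eta>) powr s * (\<Sum>j. real (Suc j) powr - s)"
    by (rule suminf_mult[OF summ])
  finally show ?thesis .
qed

text \<open>With \<delta> fixed, the covering scale \<open>\<eta> = \<delta> / (n + 1)\<close> may
  still shrink, and the bound on the premeasure tends to 0.\<close>

lemma hausdorff_measure_real_eq_0:
  fixes A :: "real set"
  assumes "s > 1"
  shows "hausdorff_measure s A = 0"
proof -
  have "hausdorff_premeasure s \<delta> A \<le> 0" if "\<delta> > 0" for \<delta>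
  proof (rule LIMSEQ_le_const)
    let ?e = "\<lambda>n. \<delta> / real (Suc n)"
    let ?K = "\<Sum>j. real (Suc j) powr - s"
    have "(\<lambda>n. 2 * ?e n) \<longlonglongrightarrow> 2 * 0"
      by (intro tendsto_mult tendsto_const LIMSEQ_Suc lim_const_over_n)
    then have "(\<lambda>n. (2 * ?e n) powr s * ?K) \<longlonglongrightarrow> 0 * ?K"
      using that assms by (intro tendsto_mult tendsto_zero_powrI[where b=s] tendsto_const) auto
    then show "(\<lambda>n. ennreal ((2 * ?e n) powr s * ?K)) \<longlonglongrightarrow> 0"
      using tendsto_ennrealI by fastforce
    have "?e n \<le> \<delta>" for n
      using that frac_le[of \<delta> \<delta> 1 "real (Suc n)"] by simp
    then show "\<exists>N. \<forall>n\<ge>N. hausdorff_premeasure s \<delta> A \<le> ennreal ((2 * ?e n) powr s * ?K)"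
      using that assms by (intro exI[of _ 0] allI impI hausdorff_premeasure_real_le) auto
  qed
  then show ?thesis by (auto simp: hausdorff_measure_def intro!: antisym SUP_least)
qed

lemma hausdorff_measure_ne_0_if_expanding:
  fixes A :: "real set" and \<phi> :: "real \<Rightarrow> real"
  assumes \<phi>: "\<phi> ` {0..<1} \<subseteq> A" and s: "0 \<le> s" "s < s'" and C: "C > 0"
    and holder: "\<And>\<rho> y y'. 0 < \<rho> \<Longrightarrow> \<rho> < 1 \<Longrightarrow> y \<in> {0..<1} \<Longrightarrow> y' \<in> {0..<1} \<Longrightarrow>
      \<bar>\<phi> y - \<phi> y'\<bar> \<le> \<rho> \<Longrightarrow> \<bar>y - y'\<bar> \<le> C * \<rho> powr s'"
  shows "hausdorff_measure s A \<noteq> 0"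
proof
  assume "hausdorff_measure s A = 0"
  moreover have "hausdorff_premeasure s (1/2) A \<le> hausdorff_measure s A"
    unfolding hausdorff_measure_def by (intro SUP_upper) auto
  \<comment> \<open>A covering set of diameter \<open>d\<close> pulls back into an interval of
    length \<open>2 * C * d powr s'\<close>, so weight below \<open>1 / (4 * C)\<close> leaves total
    length at most 1/2. The scale 1/2 keeps diameters below 1, as \<open>holder\<close>
    requires.\<close>
  ultimately have "hausdorff_premeasure s (1/2) A < ennreal (1 / (4 * C))" using C by simp
  then obtain U where U: "A \<subseteq> (\<Union>i. U i)" "\<And>i. bounded (U i)" "\<And>i. diameter (U i) \<le> 1/2"
    and small: "(\<Sum>i. diam_weight s (U i)) < ennreal (1 / (4 * C))"
    unfolding hausdorff_premeasure_def INF_less_iff by blast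
  define V where "V i = {y \<in> {0..<1}. \<phi> y \<in> U i}" for i
  define v where "v i = (SOME y. y \<in> V i)" for i
  define w where "w i = C * diameter (U i) powr s'" for i
  \<comment> \<open>The sets \<open>V i\<close> need not be measurable, so they are enclosed in
    intervals before their lengths are compared.\<close>
  define J where "J i = (if V i = {} then {} else {v i - w i..v i + w i})" for i
  have s': "s' > 0" using s by simp
  have w0: "w i \<ge> 0" for i using C by (simp add: w_def)
  have VJ: "V i \<subseteq> J i" for i
  proof
    fix y assume y: "y \<in> V i"
    then have v: "v i \<in> V i" unfolding v_def by (rule someI)
    have d: "\<bar>\<phi> y - \<phi> (v i)\<bar> \<le> diameter (U i)"
      using diameter_bounded_bound[OF U(2), of "\<phi> y" i "\<phi> (v i)"] y v by (auto simp: V_def dist_real_def)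
    have yv: "y \<in> {0..<1}" "v i \<in> {0..<1}" using y v by (auto simp: V_def)
    have "\<bar>y - v i\<bar> \<le> w i"
    proof (cases "diameter (U i) = 0")
      case False
      then show ?thesis
        unfolding w_def using U(3)[of i] diameter_ge_0[OF U(2)[of i]] by (intro holder yv d) auto
    next
      case True
      \<comment> \<open>\<open>holder\<close> demands a positive radius, so radii
        \<open>1 / (n + 2)\<close>, all below 1, are sent to 0.\<close>
      have "\<bar>y - v i\<bar> \<le> C * 0"
      proof (rule LIMSEQ_le_const)
        show "(\<lambda>n. C * (inverse (real (Suc (Suc n)))) powr s') \<longlonglongrightarrow> C * 0"
          using s' LIMSEQ_Suc[OF LIMSEQ_inverse_real_of_nat]
          by (intro tendsto_mult tendsto_const tendsto_zero_powrI[where b=s']) auto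
        show "\<exists>N. \<forall>n\<ge>N. \<bar>y - v i\<bar> \<le> C * (inverse (real (Suc (Suc n)))) powr s'"
          using d True by (intro exI[of _ 0] allI impI holder yv) (auto simp: field_simps)
      qed
      then show ?thesis using w0[of i] by simp
    qed
    with y show "y \<in> J i" by (auto simp: J_def abs_le_iff)
  qed
  have Jw: "emeasure lborel (J i) \<le> ennreal (2 * C) * diam_weight s (U i)" for i
  proof (cases "V i = {}")
    case False
    then have "U i \<noteq> {}" by (auto simp: V_def)
    have d: "0 \<le> diameter (U i)" "diameter (U i) \<le> 1" using diameter_ge_0[OF U(2)[of i]] U(3)[of i] by auto
    \<comment> \<open>For \<open>s = 0\<close> the weight is 1 by convention, and the bound is that
      a power of a diameter below 1 is at most 1.\<close>
    have "ennreal (diameter (U i) powr s') \<le> diam_weight s (U i)"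
      using \<open>U i \<noteq> {}\<close> s d s' powr_mono'[of s s' "diameter (U i)"] powr_le1[of s' "diameter (U i)"]
      by (auto simp: diam_weight_def intro!: ennreal_leI ennreal_le_1[THEN iffD2])
    then have "ennreal (2 * C) * ennreal (diameter (U i) powr s') \<le> ennreal (2 * C) * diam_weight s (U i)"
      by (intro mult_left_mono) auto
    moreover have "emeasure lborel (J i) = ennreal (2 * C) * ennreal (diameter (U i) powr s')"
      using False w0[of i] C by (simp add: J_def w_def ennreal_mult[symmetric])
    ultimately show ?thesis by simp
  qed (simp add: J_def)
  have "{0..<1} \<subseteq> (\<Union>i. J i)"
  proof
    fix y :: real assume y: "y \<in> {0..<1}"
    then obtain i where "\<phi> y \<in> U i" using \<phi> U(1) by blast
    then show "y \<in> (\<Union>i. J i)" using VJ[of i] y by (auto simp: V_def)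
  qed
  then have "emeasure lborel {0..<1::real} \<le> emeasure lborel (\<Union>i. J i)"
    by (intro emeasure_mono) (auto simp: J_def)
  also have "\<dots> \<le> (\<Sum>i. emeasure lborel (J i))"
    by (rule emeasure_subadditive_countably) (auto simp: J_def)
  also have "\<dots> \<le> (\<Sum>i. ennreal (2 * C) * diam_weight s (U i))"
    by (intro suminf_le Jw) auto
  also have "\<dots> \<le> ennreal (2 * C) * ennreal (1 / (4 * C))"
    using small by (simp add: mult_left_mono)
  also have "\<dots> = ennreal (1/2)" using C by (simp add: ennreal_mult[symmetric])
  finally have "ennreal 1 \<le> ennreal (1/2)" by simp
  then show False by (subst (asm) ennreal_le_iff) auto
qed

section \<open>Cantor sets given by restricted digits\<close>

text \<open>At level \<open>n\<close> the allowed digits are \<open>a n, \<dots>, a n + m n - 1\<close>. A level-\<open>n\<close> cell is the index \<open>b\<close> of an interval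
  \<open>[b / P, (b + 1) / P)\<close>, where \<open>P\<close> is \<open>base_prod m n\<close> in the domain and \<open>base_prod q n\<close> in the
  image.\<close>

locale digit_restriction =
  fixes q a m :: "nat \<Rightarrow> nat"
  assumes base: "basic_sequence q"
    and m_pos: "\<And>n. m (Suc n) > 0"
    and digits: "\<And>n. a (Suc n) + m (Suc n) \<le> q (Suc n)"
begin

text \<open>Reads \<open>b\<close> in the mixed base \<open>m\<close>, shifts every digit by
  \<open>a\<close>, and evaluates the result in the mixed base \<open>q\<close>.\<close>

primrec cell_map :: "nat \<Rightarrow> nat \<Rightarrow> nat" where
  "cell_map 0 b = b"
| "cell_map (Suc n) b = q (Suc n) * cell_map n (b div m (Suc n)) + (a (Suc n) + b mod m (Suc n))"

text \<open>Without a carry the value grows by 1. With a carry the prefix grows by at least 1, worth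
  \<open>q (Suc n)\<close>, which exceeds the drop of the last digit from \<open>a + m - 1\<close>
  to \<open>a\<close>.\<close>

lemma cell_map_less_Suc: "cell_map n b < cell_map n (Suc b)"
proof (induction n arbitrary: b)
  case (Suc n)
  let ?m = "m (Suc n)" and ?q = "q (Suc n)"
  show ?case
  proof (cases "Suc (b mod ?m) = ?m")
    case True
    then have *: "Suc b mod ?m = 0" "Suc b div ?m = Suc (b div ?m)"
      by (auto simp: mod_Suc div_Suc)
    have "?q * Suc (cell_map n (b div ?m)) \<le> ?q * cell_map n (Suc (b div ?m))"
      using Suc[of "b div ?m"] by (intro mult_le_mono2 Suc_leI)
    moreover have "b mod ?m < ?m" using m_pos by simp
    ultimately show ?thesis using digits[of n] by (simp add: *)
  next
    case False
    then have "Suc b mod ?m = Suc (b mod ?m)" "Suc b div ?m = b div ?m"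
      by (auto simp: mod_Suc div_Suc)
    then show ?thesis by simp
  qed
qed simp

lemma cell_map_expanding: "cell_map n b + d \<le> cell_map n (b + d)"
proof (induction d)
  case (Suc d)
  then show ?case using cell_map_less_Suc[of n "b + d"] by simp
qed simp

definition cell :: "nat \<Rightarrow> real \<Rightarrow> nat" where
  "cell n y = nat \<lfloor>real (base_prod m n) * y\<rfloor>"

lemma cell_Suc_div:
  assumes "y \<ge> 0"
  shows "cell (Suc n) y div m (Suc n) = cell n y"
proof -
  let ?m = "m (Suc n)"
  have "cell (Suc n) y div ?m = nat (\<lfloor>real (base_prod m (Suc n)) * y\<rfloor> div int ?m)"
    using assms by (simp add: cell_def nat_div_distrib)
  also have "\<lfloor>real (base_prod m (Suc n)) * y\<rfloor> div int ?m = \<lfloor>real (base_prod m (Suc n)) * y / real_of_int (int ?m)\<rfloor>"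
    by (rule floor_divide_real_eq_div[symmetric]) simp
  also have "real (base_prod m (Suc n)) * y / real_of_int (int ?m) = real (base_prod m n) * y"
    using m_pos[of n] by (simp add: base_prod_Suc)
  finally show ?thesis by (simp add: cell_def)
qed

definition image_cell :: "nat \<Rightarrow> real \<Rightarrow> nat" where
  "image_cell n y = cell_map n (cell n y)"

text \<open>Numbered so that digit \<open>n\<close>, taken in base \<open>q (Suc n)\<close>, is the
  one that locates \<open>T q n\<close>.\<close>

definition image_digit :: "nat \<Rightarrow> real \<Rightarrow> nat" where
  "image_digit n y = a (Suc n) + cell (Suc n) y mod m (Suc n)"

lemma image_cell_Suc:
  "y \<ge> 0 \<Longrightarrow> image_cell (Suc n) y = q (Suc n) * image_cell n y + image_digit n y"
  by (simp add: image_cell_def image_digit_def cell_Suc_div)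

lemma image_digit_bounds: "a (Suc n) \<le> image_digit n y" "image_digit n y < a (Suc n) + m (Suc n)"
  using m_pos by (auto simp: image_digit_def)

text \<open>The supremum of the left endpoints of nested image cells, hence a point common to all
  the closed cells. It can be a right endpoint, so the upper bounds on it below are not
  strict.\<close>

definition spread :: "real \<Rightarrow> real" where
  "spread y = (SUP n. real (image_cell n y) / real (base_prod q n))"

lemma base_prod_q_pos: "base_prod q n > 0"
  by (intro base_prod_pos basic_sequence_Suc_pos base)

lemma spread_in_cell:
  assumes y: "y \<ge> 0"
  shows "real (image_cell n y) \<le> real (base_prod q n) * spread y"
    and "real (base_prod q n) * spread y \<le> real (image_cell n y) + 1"
proof -
  let ?l = "\<lambda>n. real (image_cell n y) / real (base_prod q n)"
  let ?u = "\<lambda>n. (real (image_cell n y) + 1) / real (base_prod q n)"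
  have pos: "real (base_prod q n) > 0" "real (q (Suc n)) > 0" for n
    using base_prod_q_pos basic_sequence_Suc_pos[OF base] by auto
  have "incseq ?l"
  proof (rule incseq_SucI)
    fix n
    have "?l n = real (q (Suc n) * image_cell n y) / real (base_prod q (Suc n))"
      using pos[of n] by (simp add: base_prod_Suc)
    also have "\<dots> \<le> ?l (Suc n)"
      by (intro divide_right_mono) (auto simp: image_cell_Suc[OF y])
    finally show "?l n \<le> ?l (Suc n)" .
  qed
  moreover have "decseq ?u"
  proof (rule decseq_SucI)
    fix n
    have "image_cell (Suc n) y + 1 \<le> q (Suc n) * (image_cell n y + 1)"
      using image_digit_bounds(2)[of n y] digits[of n] by (simp add: image_cell_Suc[OF y])
    then have "real (image_cell (Suc n) y + 1) \<le> real (q (Suc n) * (image_cell n y + 1))"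
      by (simp only: of_nat_le_iff)
    then have "real (image_cell (Suc n) y) + 1 \<le> real (q (Suc n)) * (real (image_cell n y) + 1)"
      by (simp add: algebra_simps)
    then have "?u (Suc n) \<le> real (q (Suc n)) * (real (image_cell n y) + 1) / real (base_prod q (Suc n))"
      by (intro divide_right_mono) auto
    also have "\<dots> = ?u n" using pos[of n] by (simp add: base_prod_Suc)
    finally show "?u (Suc n) \<le> ?u n" .
  qed
  ultimately have lu: "?l k \<le> ?u n" for k n
  proof -
    have "?l k \<le> ?l (max k n)" using \<open>incseq ?l\<close> incseqD[of ?l k "max k n"] by auto
    also have "\<dots> \<le> ?u (max k n)" by (intro divide_right_mono) auto
    also have "\<dots> \<le> ?u n" using \<open>decseq ?u\<close> decseqD[of ?u n "max k n"] by auto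
    finally show ?thesis .
  qed
  have "?l n \<le> spread y"
    unfolding spread_def by (intro cSUP_upper bdd_aboveI[where M="?u 0"]) (use lu[of _ 0] in auto)
  then show "real (image_cell n y) \<le> real (base_prod q n) * spread y"
    using pos[of n] by (simp add: field_simps)
  have "spread y \<le> ?u n"
    unfolding spread_def by (intro cSUP_least) (use lu in auto)
  then show "real (base_prod q n) * spread y \<le> real (image_cell n y) + 1"
    using pos[of n] by (simp add: field_simps)
qed

lemma spread_in_subcell:
  assumes y: "y \<ge> 0"
  shows "real (image_cell n y) + real (image_digit n y) / real (q (Suc n)) \<le> real (base_prod q n) * spread y"
    and "real (base_prod q n) * spread y \<le> real (image_cell n y) + (real (image_digit n y) + 1) / real (q (Suc n))"
  using spread_in_cell[OF y, of "Suc n"] basic_sequence_Suc_pos[OF base, of n]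
  by (auto simp: image_cell_Suc[OF y] base_prod_Suc field_simps)

text \<open>Cell indices separate at least as fast in the image as in the domain. Two roundings cost
  1 each: \<open>spread y\<close> lies anywhere in its image cell, and \<open>y'\<close> anywhere in
  its domain cell.\<close>

lemma spread_expanding:
  assumes "0 \<le> y" "y \<le> y'" "\<bar>spread y - spread y'\<bar> \<le> \<rho>"
  shows "y' - y \<le> (\<rho> * real (base_prod q n) + 2) / real (base_prod m n)"
proof -
  let ?M = "real (base_prod m n)" and ?N = "real (base_prod q n)"
  have M: "?M > 0" using base_prod_pos[of m n, OF m_pos] by simp
  have "cell n y \<le> cell n y'" unfolding cell_def using assms by (intro nat_mono floor_mono mult_left_mono) auto
  then have "image_cell n y + (cell n y' - cell n y) \<le> image_cell n y'"
    unfolding image_cell_def using cell_map_expanding[of n "cell n y" "cell n y' - cell n y"] by simp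
  then have "real (cell n y') - real (cell n y) \<le> real (image_cell n y') - real (image_cell n y)"
    using \<open>cell n y \<le> cell n y'\<close> by linarith
  also have "\<dots> \<le> ?N * (spread y' - spread y) + 1"
    using spread_in_cell(1)[of y' n] spread_in_cell(2)[of y n] assms(1,2) by (simp add: right_diff_distrib)
  also have "\<dots> \<le> ?N * \<rho> + 1"
    using assms(3) by (intro add_right_mono mult_left_mono) auto
  finally have *: "real (cell n y') - real (cell n y) \<le> ?N * \<rho> + 1" .
  have "?M * y' \<le> real (cell n y') + 1"
    unfolding cell_def by linarith
  moreover have "real (cell n y) \<le> ?M * y"
    unfolding cell_def using assms(1) M by simp
  ultimately have "?M * (y' - y) \<le> ?N * \<rho> + 2" using * by (simp add: right_diff_distrib)
  then show ?thesis using M by (simp add: field_simps)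
qed

lemma spread_holder:
  assumes ratio: "\<And>n. q (Suc n) \<le> K * m (Suc n)"
    and growth: "\<And>n. real K ^ n \<le> C * real (base_prod q n) powr (1 - s)"
    and K: "K > 0" and s: "s < 1" and \<rho>: "0 < \<rho>" "\<rho> < 1"
    and y: "0 \<le> y" "y \<le> y'" "\<bar>spread y - spread y'\<bar> \<le> \<rho>"
  shows "y' - y \<le> 3 * real K * C * \<rho> powr s"
proof -
  have le: "base_prod q n \<le> K ^ n * base_prod m n" for n
  proof (induction n)
    case (Suc n)
    have "base_prod q (Suc n) \<le> (K * m (Suc n)) * (K ^ n * base_prod m n)"
      unfolding base_prod_Suc using Suc ratio by (intro mult_mono) auto
    then show ?case by (simp add: base_prod_Suc ac_simps)
  qed simp
  have "\<exists>n. 1 \<le> \<rho> * real (base_prod q n)"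
  proof -
    obtain n where n: "1 / \<rho> < 2 ^ n" using real_arch_pow[of 2 "1/\<rho>"] by auto
    have "2 ^ n \<le> base_prod q n" using base_prod_add[OF base, of 0 n] by auto
    then have "real (2 ^ n) \<le> real (base_prod q n)" by (simp only: of_nat_le_iff)
    with n have "1 / \<rho> \<le> real (base_prod q n)" unfolding of_nat_power of_nat_numeral by linarith
    then show ?thesis using \<rho> by (intro exI[of _ n]) (simp add: field_simps)
  qed
  \<comment> \<open>Level \<open>k + 1\<close> is the first whose image cells have length at most
    \<rho>; it is not level 0 since \<open>\<rho> < 1\<close>. Level \<open>k + 1\<close> makes the
    rounding term harmless, and level \<open>k\<close> bounds \<open>base_prod q k\<close> by
    \<open>1 / \<rho>\<close>.\<close>
  then obtain k where k: "1 \<le> \<rho> * real (base_prod q (Suc k))" "\<rho> * real (base_prod q k) < 1"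
    using exists_least_lemma[of "\<lambda>n. 1 \<le> \<rho> * real (base_prod q n)"] \<rho> by auto
  let ?M = "real (base_prod m (Suc k))" and ?N = "real (base_prod q (Suc k))"
  have M: "?M > 0" using base_prod_pos[of m "Suc k", OF m_pos] by simp
  have C: "C \<ge> 0"
    using growth[of 0] by simp
  have "y' - y \<le> (\<rho> * ?N + 2) / ?M" by (rule spread_expanding[OF y])
  also have "\<dots> \<le> (3 * \<rho> * ?N) / ?M" using k(1) M by (intro divide_right_mono) auto
  also have "\<dots> \<le> 3 * \<rho> * real K ^ Suc k"
  proof -
    have "?N \<le> real (K ^ Suc k * base_prod m (Suc k))" using le by (simp only: of_nat_le_iff)
    then have "?N / ?M \<le> real K ^ Suc k" using M by (simp add: field_simps)
    then have "3 * \<rho> * (?N / ?M) \<le> 3 * \<rho> * real K ^ Suc k" using \<rho> by (intro mult_left_mono) auto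
    then show ?thesis by simp
  qed
  also have "\<dots> \<le> 3 * \<rho> * (real K * (C * (1 / \<rho>) powr (1 - s)))"
  proof -
    have "real (base_prod q k) \<le> 1 / \<rho>" using k(2) \<rho> by (simp add: field_simps)
    then have "C * real (base_prod q k) powr (1 - s) \<le> C * (1 / \<rho>) powr (1 - s)"
      using C s by (intro mult_left_mono powr_mono2) auto
    then have "real K ^ k \<le> C * (1 / \<rho>) powr (1 - s)" using growth[of k] by linarith
    then show ?thesis using \<rho> K by (auto intro!: mult_left_mono)
  qed
  also have "\<dots> = 3 * real K * C * (\<rho> * (1 / \<rho>) powr (1 - s))" by simp
  also have "\<rho> * (1 / \<rho>) powr (1 - s) = \<rho> powr s"
    using \<rho> by (simp add: powr_divide powr_diff)
  finally show ?thesis .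
qed

end

text \<open>Once \<open>q n\<close> is at least \<open>K powr (1 / e)\<close>, the new factor
  \<open>q n powr e\<close> absorbs the new factor \<open>K\<close>; the finitely many earlier
  levels cost \<open>K ^ n0\<close>.\<close>

lemma base_prod_growth:
  fixes K :: real
  assumes q: "basic_sequence q" "infinite_in_limit q" and K: "K \<ge> 1" and e: "e > 0"
  obtains C where "C > 0" "\<And>n. K ^ n \<le> C * real (base_prod q n) powr e"
proof -
  have pos: "base_prod q n \<ge> 1" for n
    using base_prod_pos[of q n] basic_sequence_Suc_pos[OF q(1)] by (simp add: Suc_leI)
  have "eventually (\<lambda>n. q n \<ge> nat \<lceil>K powr (1 / e)\<rceil>) sequentially"
    using q(2) unfolding infinite_in_limit_def filterlim_at_top by blast
  then obtain n0 where n0: "\<And>n. n \<ge> n0 \<Longrightarrow> q n \<ge> nat \<lceil>K powr (1 / e)\<rceil>"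
    unfolding eventually_sequentially by blast
  have qK: "K \<le> real (q n) powr e" if "n \<ge> n0" for n
  proof -
    have "K powr (1 / e) \<le> real (q n)" using n0[OF that] by linarith
    then have "(K powr (1 / e)) powr e \<le> real (q n) powr e" using e by (intro powr_mono2) auto
    then show ?thesis using e K by (simp add: powr_powr)
  qed
  have "K ^ n \<le> K ^ n0 * real (base_prod q n) powr e" for n
  proof (induction n)
    case 0
    show ?case using K by simp
  next
    case (Suc n)
    show ?case
    proof (cases "Suc n \<le> n0")
      case True
      have "K ^ Suc n * 1 \<le> K ^ n0 * real (base_prod q (Suc n)) powr e"
        using True K pos[of "Suc n"] e by (intro mult_mono power_increasing ge_one_powr_ge_zero) auto
      then show ?thesis by simp
    next
      case False
      have "K * K ^ n \<le> real (q (Suc n)) powr e * (K ^ n0 * real (base_prod q n) powr e)"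
        using Suc qK[of "Suc n"] False K by (intro mult_mono) auto
      then show ?thesis by (simp add: base_prod_Suc powr_mult ac_simps)
    qed
  qed
  with K show ?thesis by (intro that[of "K ^ n0"]) auto
qed

section \<open>The orbits without distribution function\<close>

text \<open>The block from \<open>2 ^ k\<close> to \<open>2 ^ Suc k\<close> is as long as everything
  before it, so a single block shifts the running frequency by a non-vanishing amount.\<close>

definition low_index :: "nat \<Rightarrow> bool" where
  "low_index i \<longleftrightarrow> (\<exists>k. even k \<and> 2 ^ k \<le> i \<and> i < 2 ^ Suc k)"

lemma low_index_dyadic:
  assumes "2 ^ k \<le> i" "i < 2 ^ Suc k"
  shows "low_index i \<longleftrightarrow> even k"
proof -
  have "j = k" if "2 ^ j \<le> i" "i < 2 ^ Suc j" for j
  proof -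
    have "(2::nat) ^ j < 2 ^ Suc k" "(2::nat) ^ k < 2 ^ Suc j" using that assms by (meson le_less_trans)+
    then have "j < Suc k" "k < Suc j" by (simp_all only: power_strict_increasing_iff one_less_numeral_iff semiring_norm)
    then show ?thesis by simp
  qed
  then show ?thesis using assms unfolding low_index_def by blast
qed

text \<open>With \<open>F k\<close> the frequency among the first \<open>2\<^sup>k\<close> terms, \<open>F (k + 1)\<close> is \<open>(F k + 1) / 2\<close> for even \<open>k\<close>
  and \<open>F k / 2\<close> for odd \<open>k\<close>; a limit would have to be both 1 and 0.\<close>

lemma no_adf_if_low_index:
  fixes X :: "nat \<Rightarrow> real"
  assumes t: "t \<in> {0..1}" and ev: "eventually (\<lambda>i. X i \<in> {0..<t} \<longleftrightarrow> low_index i) sequentially"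
  shows "\<not> (\<exists>f. has_adf X f)"
proof
  assume "\<exists>f. has_adf X f"
  define c where "c n = card {i. i < n \<and> X i \<in> {0..<t}}" for n
  obtain L where L: "(\<lambda>n. real (c n) / real n) \<longlonglongrightarrow> L"
    using \<open>\<exists>f. has_adf X f\<close> t unfolding has_adf_def c_def by blast
  define F where "F k = real (c (2 ^ k)) / 2 ^ k" for k
  have "filterlim (\<lambda>k::nat. 2 ^ k :: nat) at_top sequentially"
    by (rule filterlim_subseq) (simp add: strict_mono_def)
  from filterlim_compose[OF L this] have F: "F \<longlonglongrightarrow> L" by (simp add: F_def[abs_def])
  obtain i0 where i0: "\<And>i. i \<ge> i0 \<Longrightarrow> X i \<in> {0..<t} \<longleftrightarrow> low_index i"
    using ev unfolding eventually_sequentially by blast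
  have rec: "F (Suc k) = (F k + (if even k then 1 else 0)) / 2" if "k \<ge> i0" for k
  proof -
    have "i0 \<le> 2 ^ k" using that less_exp[of k] by linarith
    then have low: "X i \<in> {0..<t} \<longleftrightarrow> even k" if "i \<in> {2 ^ k..<2 ^ Suc k}" for i
      using i0[of i] low_index_dyadic[of k i] that by auto
    have "{i. i < 2 ^ Suc k \<and> X i \<in> {0..<t}}
        = {i. i < 2 ^ k \<and> X i \<in> {0..<t}} \<union> (if even k then {2 ^ k..<2 ^ Suc k} else {})"
      using low by (auto simp: not_less) (metis atLeastLessThan_iff not_less power_Suc)+
    then have "c (2 ^ Suc k) = card ({i. i < 2 ^ k \<and> X i \<in> {0..<t}} \<union> (if even k then {2 ^ k..<2 ^ Suc k} else {}))"
      unfolding c_def by (rule arg_cong)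
    also have "\<dots> = c (2 ^ k) + card (if even k then {2 ^ k..<(2::nat) ^ Suc k} else {})"
      unfolding c_def by (rule card_Un_disjoint) auto
    finally have "c (2 ^ Suc k) = c (2 ^ k) + (if even k then 2 ^ k else 0)" by simp
    then show ?thesis by (simp add: F_def field_simps)
  qed
  have "L = (L + 1) / 2"
  proof (rule LIMSEQ_unique)
    show "(\<lambda>j. F (Suc (2 * j))) \<longlonglongrightarrow> L"
      using F by (rule filterlim_compose) (rule filterlim_subseq, simp add: strict_mono_def)
    have "(\<lambda>j. F (2 * j)) \<longlonglongrightarrow> L"
      using F by (rule filterlim_compose) (rule filterlim_subseq, simp add: strict_mono_def)
    then have "(\<lambda>j. (F (2 * j) + 1) / 2) \<longlonglongrightarrow> (L + 1) / 2" by (intro tendsto_intros) auto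
    moreover have "eventually (\<lambda>j. F (Suc (2 * j)) = (F (2 * j) + 1) / 2) sequentially"
      using eventually_ge_at_top[of i0] by eventually_elim (simp add: rec)
    ultimately show "(\<lambda>j. F (Suc (2 * j))) \<longlonglongrightarrow> (L + 1) / 2" by (subst tendsto_cong) auto
  qed
  moreover have "L = L / 2"
  proof (rule LIMSEQ_unique)
    show "(\<lambda>j. F (Suc (2 * j + 1))) \<longlonglongrightarrow> L"
      using F by (rule filterlim_compose) (rule filterlim_subseq, simp add: strict_mono_def)
    have "(\<lambda>j. F (2 * j + 1)) \<longlonglongrightarrow> L"
      using F by (rule filterlim_compose) (rule filterlim_subseq, simp add: strict_mono_def)
    then have "(\<lambda>j. F (2 * j + 1) / 2) \<longlonglongrightarrow> L / 2" by (intro tendsto_intros) auto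
    moreover have "eventually (\<lambda>j. F (Suc (2 * j + 1)) = F (2 * j + 1) / 2) sequentially"
      using eventually_ge_at_top[of i0] by eventually_elim (subst rec, auto)
    ultimately show "(\<lambda>j. F (Suc (2 * j + 1))) \<longlonglongrightarrow> L / 2" by (subst tendsto_cong) auto
  qed
  ultimately show False by simp
qed

definition shift_digit :: "(nat \<Rightarrow> nat) \<Rightarrow> nat \<Rightarrow> nat" where
  "shift_digit q n = (if low_index (n - 1) then 0 else q n div 2)"

text \<open>The maximum keeps one digit available at levels with \<open>q n < 4\<close>; if
  \<open>q\<close> tends to infinity there are only finitely many of these.\<close>

definition num_digits :: "(nat \<Rightarrow> nat) \<Rightarrow> nat \<Rightarrow> nat" where
  "num_digits q n = max 1 (q n div 4)"

lemma digit_restriction_block: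
  assumes "basic_sequence q"
  shows "digit_restriction q (shift_digit q) (num_digits q)"
proof
  fix n
  show "num_digits q (Suc n) > 0" by (simp add: num_digits_def)
  show "shift_digit q (Suc n) + num_digits q (Suc n) \<le> q (Suc n)"
    using basic_sequence_Suc[OF assms, of n] by (auto simp: shift_digit_def num_digits_def max_def)
qed fact

lemma spread_no_adf:
  assumes q: "basic_sequence q" "infinite_in_limit q" and y: "y \<ge> 0"
  shows "\<not> (\<exists>f. has_adf (\<lambda>n. T q n (digit_restriction.spread q (shift_digit q) (num_digits q) y)) f)"
proof -
  interpret digit_restriction q "shift_digit q" "num_digits q" by (rule digit_restriction_block[OF q(1)])
  \<comment> \<open>The threshold 3/10 separates the two cases: low digits give values at most 1/4,
    the others at least 1/3.\<close>
  have iff: "T q n (spread y) \<in> {0..<3/10} \<longleftrightarrow> low_index n" if n: "q (Suc n) \<ge> 4" for n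
  proof -
    let ?x = "real (base_prod q n) * spread y" and ?g = "real (image_cell n y)"
    let ?q = "real (q (Suc n))" and ?e = "image_digit n y"
    have num: "num_digits q (Suc n) = q (Suc n) div 4" using n by (simp add: num_digits_def)
    have "shift_digit q (Suc n) \<le> q (Suc n) div 2" by (simp add: shift_digit_def)
    moreover have "e < a + f \<Longrightarrow> a \<le> d \<Longrightarrow> 4 * f \<le> Q \<Longrightarrow> 2 * d \<le> Q \<Longrightarrow> 4 * (e + 1) \<le> 3 * Q"
      for e a f d Q :: nat by presburger
    \<comment> \<open>Staying below 3/4 of the cell excludes its right endpoint, where
      \<open>frac\<close> would wrap around to 0.\<close>
    ultimately have e: "4 * (?e + 1) \<le> 3 * q (Suc n)"
      using image_digit_bounds(2)[of n y] num times_div_less_eq_dividend by metis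
    have q0: "?q > 0" using n by simp
    have "(real ?e + 1) / ?q \<le> 3 / 4" using e q0 by (simp add: field_simps)
    moreover have "0 \<le> real ?e / ?q" by simp
    ultimately have "frac ?x = ?x - of_int (int (image_cell n y))"
      using spread_in_subcell[OF y, of n] by (intro frac_eq_diff; unfold of_int_of_nat_eq; linarith)
    then have T: "real ?e / ?q \<le> T q n (spread y)" "T q n (spread y) \<le> (real ?e + 1) / ?q"
      using spread_in_subcell[OF y, of n] by (auto simp: T_eq)
    show ?thesis
    proof (cases "low_index n")
      case True
      then have "4 * (?e + 1) \<le> q (Suc n)"
        using image_digit_bounds(2)[of n y] num by (simp add: shift_digit_def)
      then have "(real ?e + 1) / ?q \<le> 1 / 4" using q0 by (simp add: field_simps)
      then have "T q n (spread y) < 3/10" using T(2) by linarith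
      then show ?thesis using True by (simp add: T_eq frac_ge_0)
    next
      case False
      then have "?e \<ge> q (Suc n) div 2"
        using image_digit_bounds(1)[of n y] by (simp add: shift_digit_def)
      moreover have "3 * (Q div 2) \<ge> Q" if "Q \<ge> 4" for Q :: nat using that by presburger
      ultimately have "3 * ?e \<ge> q (Suc n)" using n by (meson le_trans mult_le_mono2)
      then have "real ?e / ?q \<ge> 1 / 3" using q0 by (simp add: field_simps)
      then have "\<not> T q n (spread y) < 3/10" using T(1) by linarith
      then show ?thesis using False by simp
    qed
  qed
  have "eventually (\<lambda>n. q (Suc n) \<ge> 4) sequentially"
    using q(2) unfolding infinite_in_limit_def filterlim_at_top
    by (subst eventually_sequentially_Suc) blast
  then have "eventually (\<lambda>n. T q n (spread y) \<in> {0..<3/10} \<longleftrightarrow> low_index n) sequentially"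
    by (rule eventually_mono) (rule iff)
  then show ?thesis by (intro no_adf_if_low_index[of "3/10"]) auto
qed

lemma no_adf_hausdorff_measure_ne_0:
  assumes q: "basic_sequence q" "infinite_in_limit q" and s: "0 \<le> s" "s < 1"
  shows "hausdorff_measure s {x. \<not> (\<exists>f. has_adf (\<lambda>n. T q n x) f)} \<noteq> 0"
proof -
  interpret digit_restriction q "shift_digit q" "num_digits q" by (rule digit_restriction_block[OF q(1)])
  \<comment> \<open>The Hoelder exponent must exceed \<open>s\<close>, and the gap
    \<open>1 - s'\<close> must stay positive to absorb the factors \<open>8 ^ n\<close>.\<close>
  define s' where "s' = (s + 1) / 2"
  have s': "s < s'" "s' < 1" using s by (auto simp: s'_def)
  obtain C where C: "C > 0" "\<And>n. real 8 ^ n \<le> C * real (base_prod q n) powr (1 - s')"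
    using base_prod_growth[OF q, of "real 8" "1 - s'"] s' by auto
  \<comment> \<open>Rounding down in \<open>q div 4\<close> loses less than another factor 2, hence
    8; the constant 24 below is 3 times 8.\<close>
  have ratio: "q (Suc n) \<le> 8 * num_digits q (Suc n)" for n
    by (auto simp: num_digits_def max_def)
  show ?thesis
  proof (rule hausdorff_measure_ne_0_if_expanding[where \<phi>=spread and s'=s' and C="24 * C"])
    show "spread ` {0..<1} \<subseteq> {x. \<not> (\<exists>f. has_adf (\<lambda>n. T q n x) f)}"
      using spread_no_adf[OF q] by auto
    fix \<rho> y y' :: real
    assume *: "0 < \<rho>" "\<rho> < 1" "y \<in> {0..<1}" "y' \<in> {0..<1}" "\<bar>spread y - spread y'\<bar> \<le> \<rho>"
    note holder = spread_holder[OF ratio C(2) _ s'(2) *(1,2)]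
    show "\<bar>y - y'\<bar> \<le> 24 * C * \<rho> powr s'"
      using holder[of y y'] holder[of y' y] * by (cases "y \<le> y'") (auto simp: abs_minus_commute)
  qed (use s s' C in auto)
qed

text \<open>Every exponent above 1 is admissible for any set of reals and none below 1 is by
  assumption, so the infimum is 1 whatever happens at exponent 1.\<close>

lemma hausdorff_dim_eq_1:
  fixes A :: "real set"
  assumes "\<And>s. 0 \<le> s \<Longrightarrow> s < 1 \<Longrightarrow> hausdorff_measure s A \<noteq> 0"
  shows "hausdorff_dim A = 1"
proof (rule antisym)
  show "hausdorff_dim A \<le> 1"
  proof (rule ereal_le_epsilon2)
    fix e :: real assume "0 < e"
    then have "hausdorff_dim A \<le> ereal (1 + e)"
      unfolding hausdorff_dim_def
      by (intro Inf_lower) (auto intro!: exI[of _ "1 + e"] hausdorff_measure_real_eq_0)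
    then show "hausdorff_dim A \<le> 1 + ereal e" by (simp add: one_ereal_def)
  qed
  show "1 \<le> hausdorff_dim A"
    unfolding hausdorff_dim_def
    by (rule Inf_greatest) (use assms in \<open>auto simp: one_ereal_def not_less[symmetric]\<close>)
qed

theorem mainTheorem5:
  fixes q :: "nat \<Rightarrow> nat"
  assumes "basic_sequence q" and "infinite_in_limit q"
  shows "{x :: real. \<not> (\<exists>f. has_adf (\<lambda>n. T q n x) f)} \<in> null_sets lebesgue
       \<and> hausdorff_dim {x :: real. \<not> (\<exists>f. has_adf (\<lambda>n. T q n x) f)} = 1"
  using no_adf_null[OF assms(1)] hausdorff_dim_eq_1[OF no_adf_hausdorff_measure_ne_0[OF assms]]
  by blast

end
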